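(* For every positive integer $m$ define $$C(m)=\frac{1}{2m+1}-\frac{(2m-1)!!}{(m+1)!\,2^m}.$$ Then for every real $x\in(0,1]$ and every positive integer $k$, $$\sum_{m=1}^{2k-1}(-1)^m C(m)\,x^{2m+1}<\arctan x-\frac{2x}{1+\sqrt{1+x^2}}<\sum_{m=1}^{2k}(-1)^m C(m)\,x^{2m+1}.$$
   Context: Here $(2m-1)!!=1\cdot3\cdot5\cdots(2m-1)$ is the double factorial. *)

theory Defs
  imports Complex_Main
begin

(* odd_dfact m is (2m - 1)!! = 1 * 3 * ... * (2m - 1), indexed by m to avoid
   truncated subtraction in the argument. *)
definition odd_dfact :: "nat \<Rightarrow> nat" where
  "odd_dfact m = (\<Prod>i=1..m. 2 * i - 1)"

definition C :: "nat \<Rightarrow> real" where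
  "C m = 1 / (2 * real m + 1) - real (odd_dfact m) / (fact (m + 1) * 2 ^ m)"

end

theory Submission
  imports Defs "HOL-Analysis.Generalised_Binomial_Theorem"
begin

text \<open>
  Since \<open>2x / (1 + sqrt (1 + x\<^sup>2)) = 2 (sqrt (1 + x\<^sup>2) - 1) / x\<close>, the binomial series shows that
  the function in the middle is, for \<open>0 < x < 1\<close>, the sum of the alternating series with terms
  \<open>(-1)\<^sup>m C m x\<^sup>2\<^sup>m\<^sup>+\<^sup>1\<close>. As \<open>C\<close> is positive and strictly decreasing from \<open>m = 1\<close> on, partial sums of
  fixed parity are strictly monotone and bound the sum. At \<open>x = 1\<close> the weak inequalities follow by
  continuity, and they become strict on passing to the next partial sum of the same parity.
\<close>

text \<open>This is the m-th Catalan number divided by \<open>4 ^ m\<close>.\<close>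

definition sqrt_coeff :: "nat \<Rightarrow> real" where
  "sqrt_coeff m = real (odd_dfact m) / (fact (m + 1) * 2 ^ m)"

lemma C_eq: "C m = 1 / (2 * real m + 1) - sqrt_coeff m"
  by (simp add: C_def sqrt_coeff_def)

lemma sqrt_coeff_0: "sqrt_coeff 0 = 1"
  by (simp add: sqrt_coeff_def odd_dfact_def)

lemma sqrt_coeff_Suc: "sqrt_coeff (Suc m) = sqrt_coeff m * (2 * real m + 1) / (2 * (real m + 2))"
proof -
  have "odd_dfact (Suc m) = odd_dfact m * (2 * m + 1)"
    by (simp add: odd_dfact_def)
  moreover have "fact (Suc m + 1) = (real m + 2) * fact (m + 1)"
    by (simp add: algebra_simps)
  ultimately show ?thesis
    unfolding sqrt_coeff_def by (simp add: divide_simps del: fact_Suc) (simp add: algebra_simps)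
qed

text \<open>Both sides agree at 0 and have the same ratio of consecutive terms.\<close>

lemma gbinomial_half_Suc: "2 * ((1/2 :: real) gchoose Suc m) = (-1) ^ m * sqrt_coeff m"
proof (induction m)
  case 0
  then show ?case by (simp add: sqrt_coeff_0)
next
  case (Suc m)
  have "2 * ((1/2 :: real) gchoose Suc (Suc m))
      = 2 * ((1/2) gchoose Suc m) * ((1/2 - real (Suc m)) / real (Suc (Suc m)))"
    using gbinomial_mult_1 [of "1/2 :: real" "Suc m"] by (simp add: field_simps)
  also have "\<dots> = (-1) ^ m * sqrt_coeff m * ((1/2 - real (Suc m)) / real (Suc (Suc m)))"
    by (simp only: Suc.IH)
  also have "\<dots> = (-1) ^ Suc m * sqrt_coeff (Suc m)"
    by (simp add: sqrt_coeff_Suc divide_simps) (simp add: algebra_simps)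
  finally show ?case .
qed

lemma sums_sqrt_coeff:
  fixes x :: real
  assumes "0 < x" "x < 1"
  shows "(\<lambda>m. (-1) ^ m * sqrt_coeff m * x ^ (2 * m + 1)) sums (2 * x / (1 + sqrt (1 + x\<^sup>2)))"
proof -
  have "x\<^sup>2 < 1"
    using assms by (simp add: power_less_one_iff)
  then have "(\<lambda>n. ((1/2) gchoose n) * (x\<^sup>2) ^ n) sums (1 + x\<^sup>2) powr (1/2)"
    by (intro gen_binomial_real) simp
  \<comment> \<open>Dropping the constant term 1 of the binomial series leaves only positive powers
    of \<open>x\<^sup>2\<close>, so that multiplying by \<open>2 / x\<close> gives odd powers of
    \<open>x\<close>.\<close>
  then have "(\<lambda>n. ((1/2) gchoose Suc n) * (x\<^sup>2) ^ Suc n) sums ((1 + x\<^sup>2) powr (1/2) - 1)"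
    by (subst sums_Suc_iff) simp
  then have "(\<lambda>n. 2 / x * (((1/2) gchoose Suc n) * (x\<^sup>2) ^ Suc n))
      sums (2 / x * (sqrt (1 + x\<^sup>2) - 1))"
    by (intro sums_mult) (simp add: powr_half_sqrt)
  moreover have "2 / x * (((1/2) gchoose Suc n) * (x\<^sup>2) ^ Suc n)
      = (-1) ^ n * sqrt_coeff n * x ^ (2 * n + 1)" for n
    using assms by (simp flip: gbinomial_half_Suc power_mult) (simp add: power2_eq_square)
  moreover have "2 / x * (sqrt (1 + x\<^sup>2) - 1) = 2 * x / (1 + sqrt (1 + x\<^sup>2))"
  proof -
    have "1 + sqrt (1 + x\<^sup>2) > 0"
      by (intro add_pos_nonneg) auto
    moreover have "sqrt (1 + x\<^sup>2) * sqrt (1 + x\<^sup>2) = 1 + x\<^sup>2"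
      by simp
    ultimately show ?thesis
      using assms by (simp add: divide_simps power2_eq_square algebra_simps)
  qed
  ultimately show ?thesis by simp
qed

lemma sums_C:
  fixes x :: real
  assumes "0 < x" "x < 1"
  shows "(\<lambda>m. (-1) ^ m * C m * x ^ (2 * m + 1)) sums (arctan x - 2 * x / (1 + sqrt (1 + x\<^sup>2)))"
proof -
  let ?a = "\<lambda>m. (-1) ^ m * (1 / real (m * 2 + 1) * x ^ (m * 2 + 1))"
  have "summable ?a" "arctan x = suminf ?a"
    using assms summable_arctan_series [of x] arctan_series [of x] by simp_all
  then have "?a sums arctan x"
    by (simp add: sums_iff)
  from sums_diff [OF this sums_sqrt_coeff [OF assms]] show ?thesis
    by (rule sums_cong [THEN iffD1, rotated]) (simp add: C_eq algebra_simps)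
qed

text \<open>The bound is exactly what \<open>C (Suc m) < C m\<close> amounts to.\<close>
lemma sqrt_coeff_less:
  assumes "0 < m"
  shows "sqrt_coeff m < 4 * (real m + 2) / (3 * (2 * real m + 1) * (2 * real m + 3))"
  using assms
\<comment> \<open>The induction starts with 1/4 < 4/15; at 0 the bound would be 8/9, below
  \<open>sqrt_coeff 0\<close>, which is 1.\<close>
proof (induction m rule: nat_induct_non_zero)
  case 1
  then show ?case by (simp add: sqrt_coeff_Suc sqrt_coeff_0)
next
  case (Suc m)
  have "sqrt_coeff (Suc m) < 4 * (real m + 2) / (3 * (2 * real m + 1) * (2 * real m + 3))
      * (2 * real m + 1) / (2 * (real m + 2))"
    unfolding sqrt_coeff_Suc using Suc.IH
    by (intro divide_strict_right_mono mult_strict_right_mono) auto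
  also have "\<dots> = 2 / (3 * (2 * real m + 3))"
    by (simp add: divide_simps) (simp add: algebra_simps)
  \<comment> \<open>Clearing denominators reduces this to 2m + 5 \<le> 2m + 6.\<close>
  also have "\<dots> \<le> 4 * (real (Suc m) + 2) / (3 * (2 * real (Suc m) + 1) * (2 * real (Suc m) + 3))"
    by (simp add: divide_simps) (simp add: algebra_simps)
  finally show ?case .
qed

lemma C_Suc_less:
  assumes "0 < m"
  shows "C (Suc m) < C m"
proof -
  \<comment> \<open>By the recurrence, \<open>sqrt_coeff m - sqrt_coeff (Suc m)\<close> is
    \<open>sqrt_coeff m\<close> times this first factor.\<close>
  have "C m - C (Suc m) = 3 / (2 * (real m + 2))
      * (4 * (real m + 2) / (3 * (2 * real m + 1) * (2 * real m + 3)) - sqrt_coeff m)"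
    by (simp add: C_eq sqrt_coeff_Suc divide_simps) (simp add: algebra_simps)
  also have "\<dots> > 0"
    using sqrt_coeff_less [OF assms] by (intro mult_pos_pos) auto
  finally show ?thesis by simp
qed

lemma C_pos:
  assumes "0 < m"
  shows "0 < C m"
proof -
  have "4 * (real m + 2) / (3 * (2 * real m + 1) * (2 * real m + 3)) \<le> 1 / (2 * real m + 1)"
    by (simp add: divide_simps) (simp add: algebra_simps)
  then show ?thesis
    using sqrt_coeff_less [OF assms] by (simp add: C_eq)
qed

text \<open>Strictness comes from \<open>C\<close> and not from the powers of \<open>x\<close>, so
  the endpoint 1 is covered.\<close>

lemma C_term_Suc_less:
  fixes x :: real
  assumes "0 < x" "x \<le> 1" "0 < m"
  shows "C (Suc m) * x ^ (2 * Suc m + 1) < C m * x ^ (2 * m + 1)"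
proof -
  have "C (Suc m) * x ^ (2 * Suc m + 1) \<le> C (Suc m) * x ^ (2 * m + 1)"
    using assms C_pos [of "Suc m"] by (intro mult_left_mono power_decreasing) auto
  also have "\<dots> < C m * x ^ (2 * m + 1)"
    using assms C_Suc_less by (intro mult_strict_right_mono) auto
  finally show ?thesis .
qed

definition C_partial :: "real \<Rightarrow> nat \<Rightarrow> real" where
  "C_partial x n = (\<Sum>m = 1..n. (-1) ^ m * C m * x ^ (2 * m + 1))"

text \<open>Two further steps add a positive term of even index and subtract the smaller term after
  it. For even partial sums the signs are reversed.\<close>

lemma C_partial_odd_less:
  assumes "0 < x" "x \<le> 1"
  shows "C_partial x (Suc (2 * j)) < C_partial x (Suc (2 * Suc j))"
  using C_term_Suc_less [OF assms, of "2 * j + 2"] by (simp add: C_partial_def)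

lemma C_partial_even_less:
  assumes "0 < x" "x \<le> 1"
  shows "C_partial x (2 * Suc j) < C_partial x (2 * j)"
  using C_term_Suc_less [OF assms, of "2 * j + 1"] by (simp add: C_partial_def)

lemma C_partial_weak_bounds:
  assumes "0 < x" "x < 1"
  shows "C_partial x (Suc (2 * j)) \<le> arctan x - 2 * x / (1 + sqrt (1 + x\<^sup>2))" (is "_ \<le> ?f")
    and "arctan x - 2 * x / (1 + sqrt (1 + x\<^sup>2)) \<le> C_partial x (2 * j)"
proof -
  have "(\<lambda>n. \<Sum>m\<le>n. (-1) ^ m * C m * x ^ (2 * m + 1)) \<longlonglongrightarrow> ?f"
    using sums_C [OF assms] by (simp add: sums_def_le)
  \<comment> \<open>The series starts at 0 but \<open>C_partial\<close> at 1; the extra term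
    vanishes because \<open>C 0 = 0\<close>.\<close>
  moreover have "(\<Sum>m\<le>n. (-1) ^ m * C m * x ^ (2 * m + 1)) = C_partial x n" for n
    unfolding C_partial_def
    by (simp add: C_eq sqrt_coeff_0 atMost_atLeast0 sum.atLeast_Suc_atMost)
  ultimately have lim: "C_partial x \<longlonglongrightarrow> ?f"
    by simp
  have "(\<lambda>j. C_partial x (Suc (2 * j))) \<longlonglongrightarrow> ?f" "(\<lambda>j. C_partial x (2 * j)) \<longlonglongrightarrow> ?f"
    using LIMSEQ_subseq_LIMSEQ [OF lim, of "\<lambda>j. Suc (2 * j)"]
      LIMSEQ_subseq_LIMSEQ [OF lim, of "\<lambda>j. 2 * j"]
    by (simp_all add: strict_mono_def o_def)
  moreover have "incseq (\<lambda>j. C_partial x (Suc (2 * j)))" "decseq (\<lambda>j. C_partial x (2 * j))"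
    using assms C_partial_odd_less C_partial_even_less
    by (intro incseq_SucI decseq_SucI less_imp_le; simp)+
  ultimately show "C_partial x (Suc (2 * j)) \<le> ?f" "?f \<le> C_partial x (2 * j)"
    by (auto dest: incseq_le decseq_ge)
qed

lemma C_partial_weak_bounds_closed:
  assumes "0 < x" "x \<le> 1"
  shows "C_partial x (Suc (2 * j)) \<le> arctan x - 2 * x / (1 + sqrt (1 + x\<^sup>2))"
    and "arctan x - 2 * x / (1 + sqrt (1 + x\<^sup>2)) \<le> C_partial x (2 * j)"
proof -
  define f where "f = (\<lambda>x. arctan x - 2 * x / (1 + sqrt (1 + x\<^sup>2)))"
  \<comment> \<open>Continuity of the quotient in \<open>f\<close> needs a nonzero
    denominator.\<close>
  have "1 + sqrt (1 + y\<^sup>2) \<noteq> 0" for y :: real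
    by (smt (verit) real_sqrt_ge_zero zero_le_power2)
  then have "isCont f y" for y
    unfolding f_def by (intro continuous_intros) auto
  moreover have "isCont (\<lambda>x. C_partial x n) y" for n y
    unfolding C_partial_def by (intro continuous_intros)
  ultimately have lim: "(f \<longlongrightarrow> f 1) (at_left 1)"
    "((\<lambda>x. C_partial x n) \<longlongrightarrow> C_partial 1 n) (at_left 1)" for n
    unfolding isCont_def by (blast intro: filterlim_mono at_le)+
  \<comment> \<open>Points just left of 1 lie in the open interval, where the weak bounds are known
    and pass to the limit.\<close>
  have ev: "\<forall>\<^sub>F y in at_left 1. 0 < y \<and> y < (1::real)"
    using eventually_at_left_real [of 0 1] by simp
  have "C_partial 1 (Suc (2 * j)) \<le> f 1"
    by (rule tendsto_le [OF _ lim(1) lim(2)])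
      (use ev in \<open>auto elim!: eventually_mono simp: f_def intro: C_partial_weak_bounds\<close>)
  moreover have "f 1 \<le> C_partial 1 (2 * j)"
    by (rule tendsto_le [OF _ lim(2) lim(1)])
      (use ev in \<open>auto elim!: eventually_mono simp: f_def intro: C_partial_weak_bounds\<close>)
  ultimately show "C_partial x (Suc (2 * j)) \<le> arctan x - 2 * x / (1 + sqrt (1 + x\<^sup>2))"
    and "arctan x - 2 * x / (1 + sqrt (1 + x\<^sup>2)) \<le> C_partial x (2 * j)"
    using assms C_partial_weak_bounds [of x j] unfolding f_def by (cases "x = 1"; simp)+
qed

theorem theorem3:
  fixes x :: real and k :: nat
  assumes "0 < x" and "x \<le> 1" and "0 < k"
  shows "(\<Sum>m = 1..2 * k - 1. (-1) ^ m * C m * x ^ (2 * m + 1))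
           < arctan x - 2 * x / (1 + sqrt (1 + x\<^sup>2))
       \<and> arctan x - 2 * x / (1 + sqrt (1 + x\<^sup>2))
           < (\<Sum>m = 1..2 * k. (-1) ^ m * C m * x ^ (2 * m + 1))"
proof -
  \<comment> \<open>This turns the truncated \<open>2 * k - 1\<close> into
    \<open>Suc (2 * j)\<close>.\<close>
  obtain j where "k = Suc j"
    using assms(3) gr0_conv_Suc by blast
  then have "C_partial x (2 * k - 1) < C_partial x (Suc (2 * k))"
    using C_partial_odd_less [OF assms(1,2), of j] by simp
  moreover have "C_partial x (2 * Suc k) < C_partial x (2 * k)"
    by (rule C_partial_even_less [OF assms(1,2)])
  \<comment> \<open>The weak bounds are taken two indices later, at 2k + 1 and 2k + 2.\<close>
  ultimately show ?thesis
    using C_partial_weak_bounds_closed(1) [OF assms(1,2), of k]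
      C_partial_weak_bounds_closed(2) [OF assms(1,2), of "Suc k"]
    unfolding C_partial_def by linarith
qed

end
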